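(* For any finite graph $G$ and any matching tree of $G$, the matching of $\Sigma(G)$ obtained by taking the union of all partial matchings $M(A,B,p)$ performed at the matching sites $(A,B,p)$ of the tree is Morse.
   Context: Let $G$ be a finite simple graph with vertex set $V$. For $p\in V$, $N(p)$ is the set of neighbours of $p$, and for $A\subseteq V$, $N(A)=\bigcup_{a\in A}N(a)$. $\Sigma=\Sigma(G)$ denotes the set of all independent sets of $G$ (including $\emptyset$), ordered by inclusion. Morse matchings. A finite poset $P$ is regarded as a directed graph: its Hasse diagram, with edges directed downwards (from large to small elements). A matching of $P$ is a set $M$ of pairwise disjoint edges of this graph. It is Morse (or acyclic) if the directed graph obtained by reversing the direction of the edges in $M$ is acyclic. Matching trees. For disjoint $A,B\subseteq V$ with $N(A)\subseteq B$, let $\Sigma(A,B)=\{I\in\Sigma: A\subseteq I,\ B\cap I=\emptyset\}$. A matching tree of $G$ is a plane rooted tree whose nodes are either the empty set or (sets labelled by pairs $(A,B)$ of disjoint subsets of $V$ with $N(A)\subseteq B$) of the form $\Sigma(A,B)$. The root is $\Sigma(\emptyset,\emptyset)=\Sigma$. The children of a node are as follows. If the node is the empty set, or is $\Sigma(A,B)$ with $A\cup B=V$, it is a leaf. Otherwise the node is $\Sigma(A,B)$ with $V'=V\setminus(A\cup B)\neq\emptyset$, and one chooses a vertex $p\in V'$ (the tentative pivot): (i) If $p$ has at most one neighbour in $V'$, then $(A,B,p)$ is called a matching site. Let $\Delta(A,B,p)=\{I\in\Sigma: A\subseteq I,\ B\cap I=I\cap N(p)=\emptyset\}$ and let $M(A,B,p)$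 be the perfect matching of $\Delta(A,B,p)$ formed of all pairs $(I,I\cup\{p\})$ with $I\in\Delta(A,B,p)$, $p\notin I$. The node has a unique child, $\Sigma(A,B)\setminus\Delta(A,B,p)$: this is the empty set if $p$ has no neighbour in $V'$, and is $\Sigma(A\cup\{v\},B\cup N(v))$ if $p$ has exactly one neighbour $v$ in $V'$. (ii) If $p$ has at least two neighbours in $V'$, one chooses one of these neighbours $v\in V'$, and $(A,B,v)$ is called a splitting site. The node has two children: the left child $\Sigma(A,B\cup\{v\})$ and the right child $\Sigma(A\cup\{v\},B\cup N(v))$. Every sequence of choices of tentative pivots and splitting vertices gives a matching tree. *)

theory Defs
  imports "Graph_Theory.Pair_Digraph"
begin

text \<open>
  A finite simple graph is a \<open>pair_graph\<close>: a finite symmetric loop-free arc relation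
  \<open>parcs G\<close> on the vertex set \<open>pverts G\<close>, each undirected edge being the two opposite arcs.
  For a set \<open>A\<close> of vertices, \<open>N(A)\<close> is the relational image \<open>parcs G `` A\<close>.
\<close>

section \<open>Morse matchings of a poset\<close>

definition hasse_edges :: "'b::order set \<Rightarrow> 'b rel" where
  "hasse_edges P = {(x, y). x \<in> P \<and> y \<in> P \<and> y < x \<and> \<not> (\<exists>z\<in>P. y < z \<and> z < x)}"

definition poset_matching :: "'b::order set \<Rightarrow> 'b rel \<Rightarrow> bool" where
  "poset_matching P M \<longleftrightarrow>
     M \<subseteq> hasse_edges P \<and> pairwise (\<lambda>e f. disjnt {fst e, snd e} {fst f, snd f}) M"

definition morse_matching :: "'b::order set \<Rightarrow> 'b rel \<Rightarrow> bool" where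
  "morse_matching P M \<longleftrightarrow> poset_matching P M \<and> acyclic ((hasse_edges P - M) \<union> M\<inverse>)"

section \<open>Independent sets\<close>

definition nbrs :: "'a pair_pre_digraph \<Rightarrow> 'a \<Rightarrow> 'a set" where
  "nbrs G p = {q. (p, q) \<in> parcs G}"

definition indep_sets :: "'a pair_pre_digraph \<Rightarrow> 'a set set" where
  "indep_sets G = {I. I \<subseteq> pverts G \<and> (\<forall>u\<in>I. \<forall>v\<in>I. (u, v) \<notin> parcs G)}"

definition Sigma_AB :: "'a pair_pre_digraph \<Rightarrow> 'a set \<Rightarrow> 'a set \<Rightarrow> 'a set set" where
  "Sigma_AB G A B = {I \<in> indep_sets G. A \<subseteq> I \<and> B \<inter> I = {}}"

definition Delta_ABp :: "'a pair_pre_digraph \<Rightarrow> 'a set \<Rightarrow> 'a set \<Rightarrow> 'a \<Rightarrow> 'a set set" where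
  "Delta_ABp G A B p = {I \<in> indep_sets G. A \<subseteq> I \<and> B \<inter> I = {} \<and> I \<inter> nbrs G p = {}}"

text \<open>As for \<^const>\<open>hasse_edges\<close>, a matched pair is written with the larger set first.\<close>

definition site_matching :: "'a pair_pre_digraph \<Rightarrow> 'a set \<Rightarrow> 'a set \<Rightarrow> 'a \<Rightarrow> 'a set rel" where
  "site_matching G A B p = {(insert p I, I) | I. I \<in> Delta_ABp G A B p \<and> p \<notin> I}"

section \<open>Matching trees\<close>

datatype 'a node = Empty | Sig "'a set" "'a set"

fun node_set :: "'a pair_pre_digraph \<Rightarrow> 'a node \<Rightarrow> 'a set set" where
  "node_set G Empty = {}"
| "node_set G (Sig A B) = Sigma_AB G A B"

definition valid_label :: "'a pair_pre_digraph \<Rightarrow> 'a set \<Rightarrow> 'a set \<Rightarrow> bool" where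
  "valid_label G A B \<longleftrightarrow>
     A \<subseteq> pverts G \<and> B \<subseteq> pverts G \<and> A \<inter> B = {} \<and> parcs G `` A \<subseteq> B"

definition remaining :: "'a pair_pre_digraph \<Rightarrow> 'a set \<Rightarrow> 'a set \<Rightarrow> 'a set" where
  "remaining G A B = pverts G - (A \<union> B)"

text \<open>
  \<open>Match A B p t\<close> is a node labelled \<open>(A, B)\<close> at which the matching site \<open>(A, B, p)\<close> is used,
  with unique child \<open>t\<close>. \<open>Split A B p v l r\<close> is a node labelled \<open>(A, B)\<close> with tentative pivot \<open>p\<close>
  and splitting site \<open>(A, B, v)\<close>, with left child \<open>l\<close> and right child \<open>r\<close>.
\<close>

datatype 'a mtree =
    Empty_Leaf
  | Full_Leaf "'a set" "'a set"
  | Match "'a set" "'a set" 'a "'a mtree"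
  | Split "'a set" "'a set" 'a 'a "'a mtree" "'a mtree"

fun root_node :: "'a mtree \<Rightarrow> 'a node" where
  "root_node Empty_Leaf = Empty"
| "root_node (Full_Leaf A B) = Sig A B"
| "root_node (Match A B p t) = Sig A B"
| "root_node (Split A B p v l r) = Sig A B"

fun well_formed :: "'a pair_pre_digraph \<Rightarrow> 'a mtree \<Rightarrow> bool" where
  "well_formed G Empty_Leaf \<longleftrightarrow> True"
| "well_formed G (Full_Leaf A B) \<longleftrightarrow> valid_label G A B \<and> A \<union> B = pverts G"
| "well_formed G (Match A B p t) \<longleftrightarrow>
     valid_label G A B \<and> p \<in> remaining G A B \<and>
     (nbrs G p \<inter> remaining G A B = {} \<and> root_node t = Empty \<or>
      (\<exists>v. nbrs G p \<inter> remaining G A B = {v} \<and>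
           root_node t = Sig (A \<union> {v}) (B \<union> nbrs G v))) \<and>
     well_formed G t"
| "well_formed G (Split A B p v l r) \<longleftrightarrow>
     valid_label G A B \<and> p \<in> remaining G A B \<and>
     card (nbrs G p \<inter> remaining G A B) \<ge> 2 \<and> v \<in> nbrs G p \<inter> remaining G A B \<and>
     root_node l = Sig A (B \<union> {v}) \<and>
     root_node r = Sig (A \<union> {v}) (B \<union> nbrs G v) \<and>
     well_formed G l \<and> well_formed G r"

definition matching_tree :: "'a pair_pre_digraph \<Rightarrow> 'a mtree \<Rightarrow> bool" where
  "matching_tree G t \<longleftrightarrow> well_formed G t \<and> root_node t = Sig {} {}"

fun matching_sites :: "'a mtree \<Rightarrow> ('a set \<times> 'a set \<times> 'a) set" where
  "matching_sites Empty_Leaf = {}"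
| "matching_sites (Full_Leaf A B) = {}"
| "matching_sites (Match A B p t) = insert (A, B, p) (matching_sites t)"
| "matching_sites (Split A B p v l r) = matching_sites l \<union> matching_sites r"

definition tree_matching :: "'a pair_pre_digraph \<Rightarrow> 'a mtree \<Rightarrow> 'a set rel" where
  "tree_matching G t = (\<Union>(A, B, p) \<in> matching_sites t. site_matching G A B p)"

text \<open>
  The child of a matching site is indeed what is left of \<open>\<Sigma>(A, B)\<close> once \<open>\<Delta>(A, B, p)\<close> is removed.
\<close>

lemma match_child_node_set:
  assumes "pair_graph G" and "well_formed G (Match A B p t)"
  shows "node_set G (root_node t) = Sigma_AB G A B - Delta_ABp G A B p"
proof -
  interpret pair_graph G by fact
  have sym: "(y, x) \<in> parcs G" if "(x, y) \<in> parcs G" for x y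
    using that pair_sym_arcs by (auto simp: symmetric_def dest: symD)
  have wf: "valid_label G A B" "p \<in> remaining G A B"
    using assms(2) by auto
  have *: "I \<inter> nbrs G p \<subseteq> nbrs G p \<inter> remaining G A B" if "I \<in> Sigma_AB G A B" for I
  proof
    fix x assume x: "x \<in> I \<inter> nbrs G p"
    have "x \<notin> A"
    proof
      assume "x \<in> A"
      moreover have "(x, p) \<in> parcs G"
        using x sym by (simp add: nbrs_def)
      ultimately have "p \<in> B"
        using wf(1) unfolding valid_label_def by blast
      then show False
        using wf(2) by (simp add: remaining_def)
    qed
    then show "x \<in> nbrs G p \<inter> remaining G A B"
      using that x by (auto simp: Sigma_AB_def indep_sets_def remaining_def)
  qed
  from assms(2) consider
      "nbrs G p \<inter> remaining G A B = {}" "root_node t = Empty"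
    | v where "nbrs G p \<inter> remaining G A B = {v}" "root_node t = Sig (A \<union> {v}) (B \<union> nbrs G v)"
    by auto
  then show ?thesis
  proof cases
    case 1
    then show ?thesis
      using * by (auto simp: Delta_ABp_def Sigma_AB_def)
  next
    case 2
    then have "v \<in> nbrs G p" by blast
    have "Sigma_AB G (A \<union> {v}) (B \<union> nbrs G v) = {I \<in> Sigma_AB G A B. v \<in> I}"
      by (auto simp: Sigma_AB_def nbrs_def indep_sets_def)
    moreover have "Sigma_AB G A B - Delta_ABp G A B p = {I \<in> Sigma_AB G A B. I \<inter> nbrs G p \<noteq> {}}"
      by (auto simp: Sigma_AB_def Delta_ABp_def)
    moreover have "I \<inter> nbrs G p \<noteq> {} \<longleftrightarrow> v \<in> I" if "I \<in> Sigma_AB G A B" for I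
      using *[OF that] \<open>v \<in> nbrs G p\<close> unfolding 2(1) by blast
    ultimately show ?thesis
      using 2(2) by auto
  qed
qed

text \<open>
  The label condition in \<^const>\<open>well_formed\<close> excludes no choices: it passes to the children.
\<close>

lemma valid_label_root: "valid_label G {} {}"
  by (simp add: valid_label_def)

lemma valid_label_children:
  assumes "pair_graph G" and "valid_label G A B" and "v \<in> remaining G A B"
  shows "valid_label G A (B \<union> {v})" and "valid_label G (A \<union> {v}) (B \<union> nbrs G v)"
proof -
  interpret pair_graph G by fact
  have sym: "(y, x) \<in> parcs G" if "(x, y) \<in> parcs G" for x y
    using that pair_sym_arcs by (auto simp: symmetric_def dest: symD)
  show "valid_label G A (B \<union> {v})"
    using assms(2,3) by (auto simp: valid_label_def remaining_def)
  have "(v, v) \<notin> parcs G"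
    using pair_no_loops by fastforce
  moreover have "(v, x) \<notin> parcs G" if "x \<in> A" for x
    using that sym[of v x] assms(2,3) unfolding valid_label_def remaining_def by blast
  ultimately show "valid_label G (A \<union> {v}) (B \<union> nbrs G v)"
    using assms(2,3) by (auto simp: valid_label_def remaining_def nbrs_def dest: in_arcsD2)
qed

end

theory Submission
  imports Defs
begin

text \<open>
  A matching tree cuts \<open>\<Sigma>(G)\<close> into smaller and smaller pieces, and every cut is compatible with
  inclusion. At a splitting site the independent sets containing \<open>v\<close> are separated from those
  avoiding it; at a matching site the family \<open>\<Delta>(A, B, p)\<close> of sets avoiding \<open>N(p)\<close> is separated from
  the sets that meet \<open>N(p)\<close>. In both cases one part is never entered from below: no set of the other
  part contains one of its members. A path of the modified Hasse diagram can therefore leave that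
  part by a downward edge, but it cannot come back, because the matched edges, the only ones that
  lead upwards, stay inside a part. Hence a directed cycle would live inside one part, and Morse
  matchings of the two parts unite to one of the whole (\<open>morse_matching_union\<close>). This is the
  patchwork principle of discrete Morse theory for a poset map onto a two-element chain.

  It remains to treat a single family \<open>\<Delta>(A, B, p)\<close>, in which \<open>p\<close> can be added and removed freely.
  There every upward edge adds \<open>p\<close>, while a downward edge that removes \<open>p\<close> would itself be matched
  and hence reversed. So along a path \<open>p\<close> can be gained but not lost, and a cycle has no upward edges,
  which is absurd (\<open>element_matching_morse\<close>). The theorem follows by induction on the tree.
\<close>

section \<open>Morse matchings on posets\<close>

lemma acyclic_if_subset_strict_order:
  assumes "R \<subseteq> T" and "trans T" and "irrefl T"
  shows "acyclic R"
proof -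
  have "R\<^sup>+ \<subseteq> T"
    using trancl_mono_subset[OF assms(1)] assms(2) by simp
  then show ?thesis
    using assms(3) by (auto simp: acyclic_def irrefl_def)
qed

text \<open>
  No edge returns from \<open>L\<close> to \<open>U\<close>, so stacking the two reachability relations gives a strict order.
\<close>

lemma acyclic_stacked:
  assumes disj: "U \<inter> L = {}"
    and R: "acyclic R" "R \<subseteq> U \<times> U" and S: "acyclic S" "S \<subseteq> L \<times> L"
    and Q: "Q \<subseteq> R \<union> S \<union> U \<times> L"
  shows "acyclic Q"
proof (rule acyclic_if_subset_strict_order)
  let ?T = "R\<^sup>+ \<union> S\<^sup>+ \<union> U \<times> L"
  have inU: "R\<^sup>+ \<subseteq> U \<times> U" and inL: "S\<^sup>+ \<subseteq> L \<times> L"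
    using trancl_subset_Sigma[OF R(2)] trancl_subset_Sigma[OF S(2)] by simp_all
  show "Q \<subseteq> ?T"
    using Q by (auto intro: r_into_trancl)
  show "trans ?T"
  proof (rule transI)
    fix x y z
    assume "(x, y) \<in> ?T" and "(y, z) \<in> ?T"
    then show "(x, z) \<in> ?T"
      using inU inL disj trancl_trans[of x y R z] trancl_trans[of x y S z] by auto
  qed
  show "irrefl ?T"
    using R(1) S(1) disj by (auto simp: irrefl_def acyclic_def)
qed

lemma poset_matching_subset: "poset_matching P M \<Longrightarrow> M \<subseteq> P \<times> P"
  by (auto simp: poset_matching_def hasse_edges_def)

lemma empty_matching_morse: "morse_matching P {}"
proof -
  have "acyclic (hasse_edges P)"
    by (rule acyclic_if_subset_strict_order[where T = "{(x, y). y < x}"])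
      (auto simp: hasse_edges_def trans_def irrefl_def)
  then show ?thesis
    by (simp add: morse_matching_def poset_matching_def)
qed

text \<open>
  Each part is convex in the union, since an element between two members of one part cannot lie in
  the other; so passing to a part neither creates nor destroys covering relations.
\<close>

lemma hasse_edges_Un:
  assumes no_up: "\<And>u l. u \<in> U \<Longrightarrow> l \<in> L \<Longrightarrow> \<not> u < l"
  shows "hasse_edges (U \<union> L) \<inter> U \<times> U = hasse_edges U"
    and "hasse_edges (U \<union> L) \<inter> L \<times> L = hasse_edges L"
    and "hasse_edges (U \<union> L) \<subseteq> hasse_edges U \<union> hasse_edges L \<union> U \<times> L"
proof -
  show U: "hasse_edges (U \<union> L) \<inter> U \<times> U = hasse_edges U"
    using no_up by (auto simp: hasse_edges_def)
  show L: "hasse_edges (U \<union> L) \<inter> L \<times> L = hasse_edges L"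
    using no_up by (auto simp: hasse_edges_def)
  have "hasse_edges (U \<union> L) \<subseteq> U \<times> U \<union> L \<times> L \<union> U \<times> L"
    using no_up by (auto simp: hasse_edges_def)
  then show "hasse_edges (U \<union> L) \<subseteq> hasse_edges U \<union> hasse_edges L \<union> U \<times> L"
    using U L by blast
qed

text \<open>
  Matched edges stay inside \<open>U\<close> or inside \<open>L\<close>, and so do their reversals; all other edges lead
  downwards. So \<open>L\<close> can be entered but not left.
\<close>

lemma morse_matching_union:
  assumes disj: "U \<inter> L = {}"
    and no_up: "\<And>u l. u \<in> U \<Longrightarrow> l \<in> L \<Longrightarrow> \<not> u < l"
    and morseU: "morse_matching U M" and morseL: "morse_matching L N"
  shows "morse_matching (U \<union> L) (M \<union> N)"
proof -
  have pU: "poset_matching U M" and pL: "poset_matching L N"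
    using morseU morseL by (auto simp: morse_matching_def)
  note subs = poset_matching_subset[OF pU] poset_matching_subset[OF pL]
  have "poset_matching (U \<union> L) (M \<union> N)"
    unfolding poset_matching_def
  proof
    show "M \<union> N \<subseteq> hasse_edges (U \<union> L)"
      using pU pL hasse_edges_Un(1,2)[of U L, OF no_up] by (auto simp: poset_matching_def)
    have cross: "disjnt {fst e, snd e} {fst f, snd f}" if "e \<in> M" "f \<in> N" for e f
      using that subs disj by (fastforce simp: disjnt_def)
    show "pairwise (\<lambda>e f. disjnt {fst e, snd e} {fst f, snd f}) (M \<union> N)"
      using pU pL cross cross[THEN disjnt_sym] unfolding poset_matching_def pairwise_def
      by (metis UnE)
  qed
  moreover have "acyclic ((hasse_edges (U \<union> L) - (M \<union> N)) \<union> (M \<union> N)\<inverse>)"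
  proof (rule acyclic_stacked[OF disj])
    show "acyclic ((hasse_edges U - M) \<union> M\<inverse>)" "acyclic ((hasse_edges L - N) \<union> N\<inverse>)"
      using morseU morseL by (simp_all add: morse_matching_def)
    show "(hasse_edges U - M) \<union> M\<inverse> \<subseteq> U \<times> U" "(hasse_edges L - N) \<union> N\<inverse> \<subseteq> L \<times> L"
      using subs by (auto simp: hasse_edges_def)
    show "(hasse_edges (U \<union> L) - (M \<union> N)) \<union> (M \<union> N)\<inverse>
        \<subseteq> ((hasse_edges U - M) \<union> M\<inverse>) \<union> ((hasse_edges L - N) \<union> N\<inverse>) \<union> U \<times> L"
      using hasse_edges_Un(3)[of U L, OF no_up] by blast
  qed
  ultimately show ?thesis
    by (simp add: morse_matching_def)
qed

section \<open>Matching along one element\<close>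

text \<open>
  Closure under removal of \<open>p\<close> makes every downward edge that loses \<open>p\<close> a matched one: if it runs
  from \<open>X\<close> to \<open>Y\<close>, then \<open>Y \<subseteq> X - {p}\<close>, and \<open>X\<close> covers \<open>Y\<close>, so \<open>Y = X - {p}\<close>. All remaining edges
  either gain \<open>p\<close>, or leave the membership of \<open>p\<close> unchanged and shrink the set.
\<close>

lemma element_matching_morse:
  fixes F :: "'a set set"
  assumes ins: "\<And>X. X \<in> F \<Longrightarrow> insert p X \<in> F"
    and rem: "\<And>X. X \<in> F \<Longrightarrow> X - {p} \<in> F"
  shows "morse_matching F {(insert p X, X) | X. X \<in> F \<and> p \<notin> X}" (is "morse_matching F ?M")
proof -
  have "poset_matching F ?M"
    unfolding poset_matching_def
  proof
    show "?M \<subseteq> hasse_edges F"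
      using ins by (fastforce simp: hasse_edges_def)
    show "pairwise (\<lambda>e f. disjnt {fst e, snd e} {fst f, snd f}) ?M"
      by (auto simp: pairwise_def disjnt_def insert_ident)
  qed
  moreover have "acyclic ((hasse_edges F - ?M) \<union> ?M\<inverse>)"
  proof (rule acyclic_if_subset_strict_order)
    let ?T = "{(X, Y). p \<notin> X \<and> p \<in> Y \<or> (p \<in> X \<longleftrightarrow> p \<in> Y) \<and> Y \<subset> X}"
    have "(X, Y) \<in> ?M" if "(X, Y) \<in> hasse_edges F" "p \<in> X" "p \<notin> Y" for X Y
    proof -
      have XY: "X \<in> F" "Y \<in> F" "Y \<subset> X" "\<not> (\<exists>Z\<in>F. Y \<subset> Z \<and> Z \<subset> X)"
        using that(1) by (auto simp: hasse_edges_def)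
      moreover have "Y \<subseteq> X - {p}" "X - {p} \<subset> X"
        using XY(3) that(2,3) by auto
      ultimately have "Y = X - {p}"
        using rem[of X] by blast
      then show ?thesis
        using XY that(2) by (auto simp: insert_absorb)
    qed
    then show "(hasse_edges F - ?M) \<union> ?M\<inverse> \<subseteq> ?T"
      by (auto simp: hasse_edges_def)
    show "trans ?T"
      by (auto simp: trans_def)
    show "irrefl ?T"
      by (auto simp: irrefl_def)
  qed
  ultimately show ?thesis
    by (simp add: morse_matching_def)
qed

section \<open>Matching trees\<close>

lemma nbrs_sym:
  assumes "pair_graph G"
  shows "u \<in> nbrs G v \<longleftrightarrow> v \<in> nbrs G u"
proof -
  interpret pair_graph G by fact
  show ?thesis
    using pair_sym_arcs by (auto simp: nbrs_def symmetric_def dest: symD)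
qed

lemma indep_sets_insert:
  assumes G: "pair_graph G" and "I \<in> indep_sets G" and "p \<in> pverts G" and "I \<inter> nbrs G p = {}"
  shows "insert p I \<in> indep_sets G"
proof -
  interpret pair_graph G by fact
  have "(p, p) \<notin> parcs G"
    using pair_no_loops by fastforce
  moreover have "(u, p) \<notin> parcs G \<and> (p, u) \<notin> parcs G" if "u \<in> I" for u
    using that assms(4) nbrs_sym[OF G, of u p] by (auto simp: nbrs_def)
  ultimately show ?thesis
    using assms(2,3) by (auto simp: indep_sets_def)
qed

lemma site_matching_morse:
  assumes G: "pair_graph G" and p: "p \<in> remaining G A B"
  shows "morse_matching (Delta_ABp G A B p) (site_matching G A B p)"
  unfolding site_matching_def
proof (rule element_matching_morse)
  interpret pair_graph G by fact
  have "p \<notin> nbrs G p"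
    using pair_no_loops by (fastforce simp: nbrs_def)
  then show "insert p I \<in> Delta_ABp G A B p" if "I \<in> Delta_ABp G A B p" for I
    using that p indep_sets_insert[OF G, of I p] by (auto simp: Delta_ABp_def remaining_def)
  show "I - {p} \<in> Delta_ABp G A B p" if "I \<in> Delta_ABp G A B p" for I
    using that p by (auto simp: Delta_ABp_def remaining_def indep_sets_def)
qed

text \<open>
  An independent set containing \<open>v\<close> automatically avoids \<open>N(v)\<close>, so the larger exclusion set in the
  right child loses nothing.
\<close>

lemma Sigma_AB_split:
  "Sigma_AB G A B = Sigma_AB G (A \<union> {v}) (B \<union> nbrs G v) \<union> Sigma_AB G A (B \<union> {v})"
  by (auto simp: Sigma_AB_def nbrs_def indep_sets_def)

lemma tree_matching_simps:
  "tree_matching G Empty_Leaf = {}"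
  "tree_matching G (Full_Leaf A B) = {}"
  "tree_matching G (Match A B p t) = tree_matching G t \<union> site_matching G A B p"
  "tree_matching G (Split A B p v l r) = tree_matching G r \<union> tree_matching G l"
  by (auto simp: tree_matching_def)

text \<open>
  At a matching site the upper part is the child and the lower part is \<open>\<Delta>(A, B, p)\<close>, which is closed
  under passing to smaller sets of \<open>\<Sigma>(A, B)\<close>; at a splitting site the upper part is the right child.
\<close>

lemma well_formed_tree_matching_morse:
  assumes G: "pair_graph G" and "well_formed G t"
  shows "morse_matching (node_set G (root_node t)) (tree_matching G t)"
  using assms(2)
proof (induction t)
  case Empty_Leaf
  show ?case by (simp add: tree_matching_simps empty_matching_morse)
next
  case (Full_Leaf A B)
  show ?case by (simp add: tree_matching_simps empty_matching_morse)
next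
  case (Match A B p t)
  let ?S = "Sigma_AB G A B" and ?D = "Delta_ABp G A B p"
  have child: "node_set G (root_node t) = ?S - ?D"
    using match_child_node_set[OF G Match.prems] .
  have "morse_matching ((?S - ?D) \<union> ?D) (tree_matching G t \<union> site_matching G A B p)"
  proof (rule morse_matching_union)
    show "morse_matching (?S - ?D) (tree_matching G t)"
      using Match child by auto
    show "morse_matching ?D (site_matching G A B p)"
      using Match.prems by (auto intro: site_matching_morse[OF G])
    show "\<not> I < J" if "I \<in> ?S - ?D" "J \<in> ?D" for I J
      using that by (auto simp: Sigma_AB_def Delta_ABp_def)
  qed auto
  moreover have "?D \<subseteq> ?S"
    by (auto simp: Sigma_AB_def Delta_ABp_def)
  ultimately show ?case
    by (simp add: tree_matching_simps Un_absorb2)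
next
  case (Split A B p v l r)
  let ?R = "Sigma_AB G (A \<union> {v}) (B \<union> nbrs G v)" and ?L = "Sigma_AB G A (B \<union> {v})"
  have "morse_matching (?R \<union> ?L) (tree_matching G r \<union> tree_matching G l)"
  proof (rule morse_matching_union)
    show "morse_matching ?R (tree_matching G r)" "morse_matching ?L (tree_matching G l)"
      using Split by auto
  qed (auto simp: Sigma_AB_def)
  then show ?case
    by (simp only: tree_matching_simps root_node.simps node_set.simps
        Sigma_AB_split[of G A B v])
qed

theorem proposition5:
  fixes G :: "'a pair_pre_digraph" and t :: "'a mtree"
  assumes "pair_graph G"
    and "matching_tree G t"
  shows "morse_matching (indep_sets G) (tree_matching G t)"
proof -
  have "node_set G (root_node t) = indep_sets G"
    using assms(2) by (auto simp: matching_tree_def Sigma_AB_def)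
  moreover have "well_formed G t"
    using assms(2) by (simp add: matching_tree_def)
  ultimately show ?thesis
    using well_formed_tree_matching_morse[OF assms(1)] by metis
qed

end
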